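(* Let $f\colon\mathbb{R}^d\to\mathbb{R}$ be a differentiable $\rho$-weakly convex function ($\rho\ge0$) with $\ell$-Lipschitz continuous gradient, let $g\colon\mathbb{R}^d\to\mathbb{R}$ be continuous and convex, let $h\colon\mathbb{R}^d\to(-\infty,+\infty]$ be lower semicontinuous, and let $F=f+h-g$. Let $\gamma\in(0,+\infty)$, $\tau\in[0,+\infty)$, $\nu\in(0,2)$, and suppose $$\gamma<\overline{\gamma}:=\frac{-\nu\rho+\sqrt{\nu^2\rho^2+8(2-\nu)\ell^2}}{4\ell^2},$$ with the convention $\overline\gamma=+\infty$ when $\ell=0$. Let $(x_n,y_n,z_n,w_n)_{n\in\mathbb{N}^*}$ be a sequence generated by the Backward-Douglas--Rachford algorithm: starting from $y_0,z_0,w_0\in\mathbb{R}^d$, for every $n\in\mathbb{N}$, \begin{align*} x_{n+1} &\in \operatorname{argmin}_{x}\Big(f(x)+\tfrac{1}{2\gamma}\|x-y_n\|^2\Big),\\ w_{n+1} &\in \operatorname{argmin}_{w}\Big(g^*(w)-\langle w,z_n\rangle+\tfrac{\tau}{2}\|w-w_n\|^2\Big),\\ z_{n+1} &\in \operatorname{argmin}_{z}\Big(h(z)+\tfrac{1}{2\gamma}\|z-(2x_{n+1}-y_n+\gamma w_{n+1})\|^2\Big),\\ y_{n+1} &= y_n+\nu(z_{n+1}-x_{n+1}). \end{align*} Define $\mathcal{F}\colon(\mathbb{R}^d)^4\to(-\infty,+\infty]$ by $$\mathcal{F}(x,y,z,w)=f(x)+h(z)+g^*(w)-\langle w,z\rangle+\tfrac{1}{2\gamma}\|x-y\|^2-\tfrac{1}{2\gamma}\|y-z\|^2+\tfrac{1-\nu}{\gamma}\|x-z\|^2.$$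 Then: (i) For all $n\in\mathbb{N}^*$, $$\mathcal{F}(x_{n+1},y_{n+1},z_{n+1},w_{n+1})+\tfrac{\delta}{2}\|x_{n+1}-x_n\|^2+\tfrac{\tau}{2}\|w_{n+1}-w_n\|^2\le\mathcal{F}(x_n,y_n,z_n,w_n),$$ where $\delta:=\frac{2-\nu-\nu\rho\gamma-2\ell^2\gamma^2}{\nu\gamma}$; consequently $(\mathcal{F}(x_n,y_n,z_n,w_n))_{n\in\mathbb{N}^*}$ is nonincreasing. (ii) If $F$ is coercive, then $(x_n,y_n,z_n,w_n)_{n\in\mathbb{N}^*}$ is bounded and $\|x_{n+1}-x_n\|\to0$, $\|y_{n+1}-y_n\|\to0$, $\|z_{n+1}-z_n\|\to0$, $\tau\|w_{n+1}-w_n\|\to0$ as $n\to\infty$. Moreover, every cluster point $(\overline x,\overline y,\overline z,\overline w)$ satisfies $\overline x=\overline z$, $0\in\nabla f(\overline z)+\partial h(\overline z)-\partial g(\overline z)$, and $$\lim_{n\to\infty}F(z_n)=\lim_{n\to\infty}\mathcal{F}(x_n,y_n,z_n,w_n)=\mathcal{F}(\overline x,\overline y,\overline z,\overline w)=F(\overline z).$$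
   Context: $f$ is $\rho$-weakly convex if $f+\frac{\rho}{2}\|\cdot\|^2$ is convex. $F$ is coercive if $F(x)\to+\infty$ as $\|x\|\to+\infty$. $g^*(v)=\sup_x(\langle v,x\rangle-g(x))$ is the Fenchel conjugate. $\partial h$ denotes the limiting subdifferential: $x^*\in\partial h(x)$ iff there exist $x_k\to x$ with $h(x_k)\to h(x)$ and $x_k^*\to x^*$ with $x_k^*\in\widehat\partial h(x_k)$, where $\widehat\partial h(x)=\{x^*:\liminf_{y\to x}\frac{h(y)-h(x)-\langle x^*,y-x\rangle}{\|y-x\|}\ge0\}$ (empty if $|h(x)|=\infty$); $\partial g$ is the convex subdifferential. $\mathbb{N}^*=\{1,2,\dots\}$.
   Formalization: The function h is additionally assumed proper (not identically +∞); otherwise F ≡ +∞ is trivially coercive, every z is a minimizer in the z-step, and the boundedness claim in (ii) fails, e.g. with f = g = 0. *)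

theory Defs
  imports "HOL-Analysis.Analysis"
begin

definition weakly_convex :: "real \<Rightarrow> ('a::real_normed_vector \<Rightarrow> real) \<Rightarrow> bool" where
  "weakly_convex \<rho> f \<longleftrightarrow> convex_on UNIV (\<lambda>x. f x + \<rho> / 2 * (norm x)\<^sup>2)"

definition lsc :: "('a::topological_space \<Rightarrow> ereal) \<Rightarrow> bool" where
  "lsc h \<longleftrightarrow> (\<forall>x. h x \<le> Liminf (at x) h)"

definition coercive :: "('a::real_normed_vector \<Rightarrow> ereal) \<Rightarrow> bool" where
  "coercive F \<longleftrightarrow> (F \<longlongrightarrow> PInfty) at_infinity"

definition fconj :: "('a::real_inner \<Rightarrow> real) \<Rightarrow> 'a \<Rightarrow> ereal" where
  "fconj g v = (SUP x. ereal (inner v x - g x))"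

definition argmin :: "('a \<Rightarrow> ereal) \<Rightarrow> 'a set" where
  "argmin \<phi> = {x. \<forall>y. \<phi> x \<le> \<phi> y}"

definition cvx_subdiff :: "('a::real_inner \<Rightarrow> real) \<Rightarrow> 'a \<Rightarrow> 'a set" where
  "cvx_subdiff g x = {v. \<forall>y. g y \<ge> g x + inner v (y - x)}"

definition frechet_subdiff :: "('a::real_inner \<Rightarrow> ereal) \<Rightarrow> 'a \<Rightarrow> 'a set" where
  "frechet_subdiff h x =
     (if \<bar>h x\<bar> = \<infinity> then {}
      else {u. Liminf (at x) (\<lambda>y. (h y - h x - ereal (inner u (y - x))) / ereal (norm (y - x))) \<ge> 0})"

definition limiting_subdiff :: "('a::real_inner \<Rightarrow> ereal) \<Rightarrow> 'a \<Rightarrow> 'a set" where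
  "limiting_subdiff h x =
     {u. \<exists>xs us. xs \<longlonglongrightarrow> x \<and> (\<lambda>k. h (xs k)) \<longlonglongrightarrow> h x \<and> us \<longlonglongrightarrow> u
                 \<and> (\<forall>k. us k \<in> frechet_subdiff h (xs k))}"

definition bdr_merit ::
  "('a::real_inner \<Rightarrow> real) \<Rightarrow> ('a \<Rightarrow> ereal) \<Rightarrow> ('a \<Rightarrow> real) \<Rightarrow> real \<Rightarrow> real
    \<Rightarrow> 'a \<Rightarrow> 'a \<Rightarrow> 'a \<Rightarrow> 'a \<Rightarrow> ereal" where
  "bdr_merit f h g \<gamma> \<nu> x y z w =
     ereal (f x) + h z + fconj g w
     + ereal (- inner w z + 1 / (2 * \<gamma>) * (norm (x - y))\<^sup>2
              - 1 / (2 * \<gamma>) * (norm (y - z))\<^sup>2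
              + (1 - \<nu>) / \<gamma> * (norm (x - z))\<^sup>2)"

end

theory Submission
  imports Defs
begin

text \<open>The merit function is followed through the updates of \<open>w\<close>, \<open>z\<close>, \<open>y\<close>, \<open>x\<close>. The first two
  decrease it by minimality, and the increase \<open>\<nu>/\<gamma> \<parallel>z - x\<parallel>\<^sup>2\<close> caused by the \<open>y\<close>-step is exactly
  absorbed by the surplus of the \<open>z\<close>-step. Optimality of the \<open>x\<close>-step,
  \<open>y\<^sub>n = x\<^sub>n\<^sub>+\<^sub>1 + \<gamma> \<nabla>f(x\<^sub>n\<^sub>+\<^sub>1)\<close>, expresses \<open>\<nu> (z\<^sub>n - x\<^sub>n)\<close> through the increments of \<open>x\<close> and
  \<open>\<nabla>f\<close>, and weak convexity turns what remains into \<open>- \<delta>/2 \<parallel>x\<^sub>n\<^sub>+\<^sub>1 - x\<^sub>n\<parallel>\<^sup>2\<close>. Conversely, the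
  merit function dominates \<open>F(z\<^sub>n)\<close> because \<open>L\<gamma> < 1\<close>, so coercivity bounds the iterates and the
  increments vanish. Then the gap between the merit function and \<open>F(z\<^sub>n)\<close> tends to \<open>0\<close>, which
  yields a limit of \<open>h(z\<^sub>n)\<close> along a convergent subsequence; lower semicontinuity bounds it below by
  the value of \<open>h\<close> at the cluster point, and minimality in the \<open>z\<close>-step bounds it above.\<close>

subsection \<open>Smooth and weakly convex functions\<close>

text \<open>Dividing by \<open>t\<close> and letting it decrease to 0 leaves \<open>A\<close>: the
  first-variation argument for a minimizer along a segment.\<close>

lemma nonneg_of_quadratic_nonneg:
  fixes A B :: real
  assumes "\<And>t. 0 < t \<Longrightarrow> t \<le> 1 \<Longrightarrow> 0 \<le> t * A + t\<^sup>2 * B"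
  shows "0 \<le> A"
proof (rule tendsto_lowerbound)
  show "((\<lambda>t. A + t * B) \<longlongrightarrow> A) (at_right 0)"
    by (auto intro!: tendsto_eq_intros)
  have "0 \<le> A + t * B" if "0 < t" "t < 1" for t
    using assms[of t] that zero_le_mult_iff[of t "A + t * B"]
    by (simp add: power2_eq_square algebra_simps)
  then show "\<forall>\<^sub>F t in at_right 0. 0 \<le> A + t * B"
    by (auto simp: eventually_at_right_field intro!: exI[of _ 1])
qed simp

lemma has_real_derivative_along_line:
  fixes f :: "'a::real_inner \<Rightarrow> real"
  assumes "(f has_derivative (\<lambda>v. inner (G (u + t *\<^sub>R d)) v)) (at (u + t *\<^sub>R d))"
  shows "((\<lambda>t. f (u + t *\<^sub>R d)) has_real_derivative inner (G (u + t *\<^sub>R d)) d) (at t)"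
proof -
  have "((\<lambda>t. u + t *\<^sub>R d) has_derivative (\<lambda>h. h *\<^sub>R d)) (at t)"
    by (auto intro!: derivative_eq_intros)
  from has_derivative_compose[OF this assms] show ?thesis
    unfolding has_field_derivative_def by (rule has_derivative_eq_rhs) (simp add: fun_eq_iff)
qed

text \<open>The added quadratic makes the restriction to a line convex, hence above its tangent;
  expanding that quadratic around \<open>u\<close> leaves the error term.\<close>

lemma weakly_convex_above_tangent:
  fixes f :: "'a::real_inner \<Rightarrow> real"
  assumes wc: "weakly_convex \<rho> f"
    and df: "(f has_derivative (\<lambda>v. inner (G u) v)) (at u)"
  shows "f u + inner (G u) (v - u) - \<rho> / 2 * (norm (v - u))\<^sup>2 \<le> f v"
proof -
  define \<phi> where "\<phi> x = f x + \<rho> / 2 * inner x x" for x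
  have cvx: "convex_on UNIV \<phi>"
    using wc by (simp add: weakly_convex_def \<phi>_def[abs_def] power2_norm_eq_inner)
  \<comment> \<open>The base point is written with a zero multiple of \<open>v - u\<close> so that
    it matches the line at parameter 0.\<close>
  have d\<phi>: "(\<phi> has_derivative (\<lambda>v. inner (G u + \<rho> *\<^sub>R u) v)) (at (u + 0 *\<^sub>R (v - u)))"
    unfolding \<phi>_def[abs_def]
    by (auto intro!: derivative_eq_intros df simp: inner_simps inner_commute)
  have "convex_on UNIV (\<lambda>t. \<phi> (u + t *\<^sub>R (v - u)))"
  proof (rule convex_onI)
    fix t a b :: real assume t: "0 < t" "t < 1"
    have "u + ((1 - t) *\<^sub>R a + t *\<^sub>R b) *\<^sub>R (v - u) =
        (1 - t) *\<^sub>R (u + a *\<^sub>R (v - u)) + t *\<^sub>R (u + b *\<^sub>R (v - u))"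
      by (simp add: algebra_simps)
    then show "\<phi> (u + ((1 - t) *\<^sub>R a + t *\<^sub>R b) *\<^sub>R (v - u)) \<le>
        (1 - t) * \<phi> (u + a *\<^sub>R (v - u)) + t * \<phi> (u + b *\<^sub>R (v - u))"
      using convex_onD[OF cvx, of t] t by auto
  qed auto
  from convex_on_imp_above_tangent[OF this, of 0 1,
      OF _ _ _ has_field_derivative_at_within[OF has_real_derivative_along_line[OF d\<phi>]]]
  have "inner (G u + \<rho> *\<^sub>R u) (v - u) \<le> \<phi> v - \<phi> u"
    by simp
  then show ?thesis
    by (simp add: \<phi>_def power2_norm_eq_inner inner_simps inner_commute algebra_simps)
qed

text \<open>No integral is taken: up to a constant, \<open>\<psi>\<close> is the gap between
  \<open>f\<close> and its quadratic majorant along the segment, and its derivative is nonpositive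
  by Cauchy-Schwarz and the Lipschitz bound.\<close>

lemma lipschitz_gradient_upper_bound:
  fixes f :: "'a::real_inner \<Rightarrow> real"
  assumes df: "\<And>u. (f has_derivative (\<lambda>v. inner (G u) v)) (at u)"
    and lip: "L-lipschitz_on UNIV G"
  shows "f v \<le> f u + inner (G u) (v - u) + L / 2 * (norm (v - u))\<^sup>2"
proof -
  define d where "d = v - u"
  define \<psi> where "\<psi> t = f (u + t *\<^sub>R d) - t * inner (G u) d - L / 2 * t\<^sup>2 * (norm d)\<^sup>2" for t
  have "\<psi> 0 \<ge> \<psi> 1"
  proof (rule DERIV_nonpos_imp_nonincreasing[of 0 1 \<psi>])
    fix t :: real assume t: "0 \<le> t" "t \<le> 1"
    have "(\<psi> has_real_derivative
        inner (G (u + t *\<^sub>R d)) d - inner (G u) d - L * t * (norm d)\<^sup>2) (at t)"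
      unfolding \<psi>_def[abs_def]
      by (auto intro!: derivative_eq_intros has_real_derivative_along_line df)
    moreover have "inner (G (u + t *\<^sub>R d) - G u) d \<le> norm (G (u + t *\<^sub>R d) - G u) * norm d"
      by (rule norm_cauchy_schwarz)
    moreover have "\<dots> \<le> (L * t * norm d) * norm d"
      using lipschitz_onD[OF lip, of "u + t *\<^sub>R d" u] t
      by (intro mult_right_mono) (auto simp: dist_norm)
    ultimately show "\<exists>y. (\<psi> has_real_derivative y) (at t) \<and> y \<le> 0"
      by (intro exI conjI) (auto simp: inner_simps power2_eq_square)
  qed simp
  then show ?thesis
    by (simp add: \<psi>_def d_def)
qed

subsection \<open>Convex subgradients and conjugates\<close>

text \<open>The graph point over \<open>u\<close> is separated from the strict epigraph; once the
  last coordinate \<open>q\<close> of the normal is positive, dividing by it gives a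
  subgradient.\<close>

lemma cvx_subdiff_nonempty:
  fixes g :: "'a::euclidean_space \<Rightarrow> real"
  assumes "convex_on UNIV g"
  shows "cvx_subdiff g u \<noteq> {}"
proof -
  define T where "T = {xt. g (fst xt) < snd xt}"
  have "convex T"
    unfolding convex_alt
  proof (intro ballI allI impI)
    fix p q and t :: real
    assume pq: "p \<in> T" "q \<in> T" and t: "0 \<le> t \<and> t \<le> 1"
    have "g ((1 - t) *\<^sub>R fst p + t *\<^sub>R fst q) \<le> (1 - t) * g (fst p) + t * g (fst q)"
      using convex_onD[OF assms] t by auto
    also have "\<dots> < (1 - t) * snd p + t * snd q"
    proof (cases "t = 0")
      case False
      then show ?thesis
        using pq t by (intro add_le_less_mono mult_left_mono mult_strict_left_mono)
          (auto simp: T_def)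
    qed (use pq in \<open>auto simp: T_def\<close>)
    finally show "(1 - t) *\<^sub>R p + t *\<^sub>R q \<in> T"
      by (simp add: T_def)
  qed
  moreover have "(u, g u + 1) \<in> T" "{(u, g u)} \<inter> T = {}"
    by (auto simp: T_def)
  ultimately have "\<exists>a b. a \<noteq> 0 \<and> (\<forall>x\<in>{(u, g u)}. inner a x \<le> b) \<and> (\<forall>x\<in>T. b \<le> inner a x)"
    by (intro separating_hyperplane_sets) auto
  then obtain a b where a: "a \<noteq> 0" "inner a (u, g u) \<le> b" "\<And>x. x \<in> T \<Longrightarrow> b \<le> inner a x"
    by blast
  obtain p q where pq: "a = (p, q)"
    by (cases a)
  have sep: "inner p u + q * g u \<le> inner p x + q * t" if "g x < t" for x t
    using a(2) a(3)[of "(x, t)"] that by (simp add: pq T_def)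
  have "q \<ge> 0"
    using sep[of u "g u + 1"] by (simp add: algebra_simps)
  \<comment> \<open>A vertical hyperplane is excluded: moving from \<open>u\<close> by
    \<open>- p\<close> would force \<open>p = 0\<close>, hence a zero normal.\<close>
  moreover have "q \<noteq> 0"
  proof
    assume "q = 0"
    then have "inner p u \<le> inner p (u - p)"
      using sep[of "u - p" "g (u - p) + 1"] by simp
    then have "inner p p \<le> 0"
      by (simp add: inner_simps)
    then have "p = 0"
      using inner_gt_zero_iff[of p] by linarith
    with \<open>q = 0\<close> a(1) pq show False
      by (simp add: zero_prod_def)
  qed
  ultimately have q: "q > 0"
    by simp
  \<comment> \<open>Separation covers only heights strictly above the graph; the height
    \<open>g x + e / q\<close> costs exactly \<open>e\<close>.\<close>
  have "inner p u + q * g u \<le> inner p x + q * g x" for x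
  proof (rule field_le_epsilon)
    fix e :: real assume "e > 0"
    then show "inner p u + q * g u \<le> inner p x + q * g x + e"
      using sep[of x "g x + e / q"] q by (simp add: algebra_simps)
  qed
  then have "g x \<ge> g u + inner (- (1 / q) *\<^sub>R p) (x - u)" for x
    using q by (simp add: field_simps inner_simps)
  then have "- (1 / q) *\<^sub>R p \<in> cvx_subdiff g u"
    unfolding cvx_subdiff_def by blast
  then show ?thesis
    by blast
qed

text \<open>A unit step along \<open>v\<close> turns the subgradient inequality into
  \<open>norm v \<le> g (u + sgn v) - g u\<close>, and \<open>g\<close> is bounded on the ball
  enlarged by 1.\<close>

lemma cvx_subdiff_bounded_on_bounded:
  fixes g :: "'a::euclidean_space \<Rightarrow> real"
  assumes "continuous_on UNIV g" "bounded B"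
  obtains C where "\<And>u v. u \<in> B \<Longrightarrow> v \<in> cvx_subdiff g u \<Longrightarrow> norm v \<le> C"
proof -
  obtain R where R: "\<And>u. u \<in> B \<Longrightarrow> norm u \<le> R"
    using assms(2) by (auto simp: bounded_iff)
  have "bounded (g ` cball 0 (R + 1))"
    using assms(1) by (intro compact_imp_bounded compact_continuous_image)
      (auto intro: continuous_on_subset)
  then obtain K where K: "\<And>u. norm u \<le> R + 1 \<Longrightarrow> \<bar>g u\<bar> \<le> K"
    unfolding bounded_iff by (metis imageI mem_cball_0 real_norm_def)
  have "norm v \<le> 2 * K" if u: "u \<in> B" and v: "v \<in> cvx_subdiff g u" for u v
  proof -
    have "norm (u + sgn v) \<le> R + 1"
      using norm_triangle_ineq[of u "sgn v"] R[OF u] by (auto simp: norm_sgn split: if_splits)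
    moreover have "g (u + sgn v) \<ge> g u + inner v (sgn v)"
      using v unfolding cvx_subdiff_def by (metis (mono_tags, lifting) add_diff_cancel_left' mem_Collect_eq)
    moreover have "inner v (sgn v) = norm v"
      by (cases "v = 0") (simp_all add: sgn_div_norm dot_square_norm power2_eq_square)
    ultimately show ?thesis
      using K[of "u + sgn v"] K[of u] R[OF u] by auto
  qed
  then show ?thesis
    using that by blast
qed

lemma cvx_subdiff_closed:
  fixes g :: "'a::real_inner \<Rightarrow> real"
  assumes "continuous_on UNIV g" "\<And>k. v k \<in> cvx_subdiff g (u k)" "u \<longlonglongrightarrow> a" "v \<longlonglongrightarrow> b"
  shows "b \<in> cvx_subdiff g a"
  unfolding cvx_subdiff_def
proof clarify
  fix y
  have "(\<lambda>k. g (u k)) \<longlonglongrightarrow> g a"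
    using assms(1,3) continuous_on_tendsto_compose by fastforce
  then have "(\<lambda>k. g (u k) + inner (v k) (y - u k)) \<longlonglongrightarrow> g a + inner b (y - a)"
    using assms(3,4) by (intro tendsto_intros)
  then show "g a + inner b (y - a) \<le> g y"
    by (rule LIMSEQ_le_const2) (use assms(2) in \<open>auto simp: cvx_subdiff_def\<close>)
qed

lemma fconj_ge: "ereal (inner v u - g u) \<le> fconj g v"
  unfolding fconj_def by (rule SUP_upper) simp

text \<open>The subgradient inequality says that the supremum is attained at \<open>u\<close>; in
  particular the conjugate is finite at \<open>v\<close>.\<close>

lemma fconj_eq_on_cvx_subdiff:
  assumes "v \<in> cvx_subdiff g u"
  shows "fconj g v = ereal (inner v u - g u)"
proof (rule antisym)
  show "fconj g v \<le> ereal (inner v u - g u)"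
    unfolding fconj_def
  proof (rule SUP_least)
    fix x
    have "g x \<ge> g u + inner v (x - u)"
      using assms by (auto simp: cvx_subdiff_def)
    then show "ereal (inner v x - g x) \<le> ereal (inner v u - g u)"
      by (simp add: inner_simps)
  qed
qed (rule fconj_ge)

text \<open>Fenchel duality turns the optimality condition \<open>z - \<tau> (w1 - w0) \<in> \<partial>g\<^sup>* w1\<close>
  of the proximal step into the primal inclusion \<open>w1 \<in> \<partial>g (z - \<tau> (w1 - w0))\<close>;
  it suffices to test the former against one subgradient of \<open>g\<close> at that point.\<close>

lemma argmin_fconj_prox_in_cvx_subdiff:
  fixes g :: "'a::euclidean_space \<Rightarrow> real"
  assumes g: "convex_on UNIV g"
    and w1: "w1 \<in> argmin (\<lambda>u. fconj g u + ereal (- inner u z + \<tau> / 2 * (norm (u - w0))\<^sup>2))"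
  shows "w1 \<in> cvx_subdiff g (z - \<tau> *\<^sub>R (w1 - w0))"
proof -
  define p where "p = z - \<tau> *\<^sub>R (w1 - w0)"
  obtain v where v: "v \<in> cvx_subdiff g p"
    using cvx_subdiff_nonempty[OF g] by blast
  define V where "V = inner v p - g p"
  have V: "fconj g v = ereal V"
    unfolding V_def by (rule fconj_eq_on_cvx_subdiff[OF v])
  define q where "q u = - inner u z + \<tau> / 2 * (norm (u - w0))\<^sup>2" for u
  have min: "fconj g w1 + ereal (q w1) \<le> fconj g u + ereal (q u)" for u
    using w1 by (simp add: argmin_def q_def)
  \<comment> \<open>Minimality against \<open>v\<close> bounds the conjugate at \<open>w1\<close>
    from above; the term of the supremum at 0 bounds it from below.\<close>
  obtain G where G: "fconj g w1 = ereal G"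
    using min[of v] fconj_ge[of w1 0 g] by (cases "fconj g w1") (auto simp: V)
  have le: "inner w1 u - g u \<le> G" for u
    using fconj_ge[of w1 u g] by (simp add: G)
  have "0 \<le> V - G - inner (v - w1) p"
  proof (rule nonneg_of_quadratic_nonneg)
    fix t :: real assume t: "0 < t" "t \<le> 1"
    \<comment> \<open>Convexity of the conjugate along the segment, obtained termwise under the
      supremum.\<close>
    have "fconj g (w1 + t *\<^sub>R (v - w1)) \<le> ereal ((1 - t) * G + t * V)"
      unfolding fconj_def
    proof (rule SUP_least)
      fix u
      have "inner v u - g u \<le> V"
        using fconj_ge[of v u g] by (simp add: V)
      then have "(1 - t) * (inner w1 u - g u) + t * (inner v u - g u) \<le> (1 - t) * G + t * V"
        using t le by (intro add_mono mult_left_mono) auto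
      then show "ereal (inner (w1 + t *\<^sub>R (v - w1)) u - g u) \<le> ereal ((1 - t) * G + t * V)"
        by (simp add: inner_simps algebra_simps)
    qed
    from add_right_mono[OF this, of "ereal (q (w1 + t *\<^sub>R (v - w1)))"]
    have "ereal (G + q w1) \<le> ereal ((1 - t) * G + t * V) + ereal (q (w1 + t *\<^sub>R (v - w1)))"
      using order_trans[OF min[of "w1 + t *\<^sub>R (v - w1)"], of "ereal ((1 - t) * G + t * V + q (w1 + t *\<^sub>R (v - w1)))"]
      by (simp add: G)
    then have "G + q w1 \<le> (1 - t) * G + t * V + q (w1 + t *\<^sub>R (v - w1))"
      by simp
    \<comment> \<open>The point \<open>p\<close> arises as the negative gradient of \<open>q\<close>
      at \<open>w1\<close>.\<close>
    moreover have "q (w1 + t *\<^sub>R (v - w1)) =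
        q w1 - t * inner (v - w1) p + t\<^sup>2 * (\<tau> / 2 * (norm (v - w1))\<^sup>2)"
      unfolding q_def p_def power2_norm_eq_inner
      by (simp add: inner_simps inner_commute power2_eq_square algebra_simps)
    ultimately show "0 \<le> t * (V - G - inner (v - w1) p) + t\<^sup>2 * (\<tau> / 2 * (norm (v - w1))\<^sup>2)"
      by (simp add: algebra_simps)
  qed
  then have "G \<le> inner w1 p - g p"
    by (simp add: V_def inner_simps)
  then have "g y \<ge> g p + inner w1 (y - p)" for y
    using le[of y] by (simp add: inner_simps)
  then show ?thesis
    by (auto simp: cvx_subdiff_def p_def)
qed

subsection \<open>Lower semicontinuity and proximal points\<close>

lemma lsc_eventually_gt:
  assumes "lsc h" "c < h a" "(u \<longlongrightarrow> a) F"
  shows "\<forall>\<^sub>F n in F. c < h (u n)"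
proof -
  have "\<forall>\<^sub>F x in at a. c < h x"
    using assms(1,2) by (intro less_LiminfD) (auto simp: lsc_def intro: less_le_trans)
  \<comment> \<open>The limit in \<open>lsc\<close> is punctured; the hypothesis on
    \<open>h a\<close> supplies the point itself, since \<open>u\<close> may take the value
    \<open>a\<close>.\<close>
  then have "\<forall>\<^sub>F x in nhds a. c < h x"
    unfolding eventually_at_filter by (rule eventually_mono) (use assms(2) in auto)
  then show ?thesis
    using assms(3) by (rule eventually_compose_filterlim)
qed

text \<open>Each point has a neighbourhood with a real lower bound; a finite subcover leaves
  finitely many bounds.\<close>

lemma lsc_bounded_below_on_compact:
  fixes h :: "'a::t2_space \<Rightarrow> ereal"
  assumes h: "lsc h" "\<And>u. h u \<noteq> -\<infinity>" and K: "compact K"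
  obtains c :: real where "\<And>u. u \<in> K \<Longrightarrow> ereal c \<le> h u"
proof -
  have "\<exists>S c. open S \<and> a \<in> S \<and> (\<forall>u\<in>S. ereal c < h u)" for a
  proof -
    obtain c :: real where "ereal c < h a"
      using h(2)[of a] ereal_dense2[of "-\<infinity>" "h a"] by auto
    then have "\<forall>\<^sub>F u in nhds a. ereal c < h u"
      using lsc_eventually_gt[OF h(1) _ filterlim_ident] by blast
    then show ?thesis
      by (auto simp: eventually_nhds)
  qed
  then have "\<forall>a. \<exists>S c. open S \<and> a \<in> S \<and> (\<forall>u\<in>S. ereal c < h u)"
    by blast
  from choice[OF this] obtain S
    where "\<forall>a. \<exists>c. open (S a) \<and> a \<in> S a \<and> (\<forall>u\<in>S a. ereal c < h u)" ..
  from choice[OF this] obtain c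
    where "\<forall>a. open (S a) \<and> a \<in> S a \<and> (\<forall>u\<in>S a. ereal (c a) < h u)" ..
  then have S: "\<And>a. open (S a)" "\<And>a. a \<in> S a" "\<And>a u. u \<in> S a \<Longrightarrow> ereal (c a) < h u"
    by auto
  have "K \<subseteq> (\<Union>a. S a)"
    using S(2) by blast
  then obtain T where T: "finite T" "K \<subseteq> (\<Union>a\<in>T. S a)"
    using compactE_image[OF K, of UNIV S] S(1) by (metis (no_types, lifting))
  show ?thesis
  \<comment> \<open>The extra 0 keeps the set nonempty when the subcover is empty.\<close>
  proof (rule that[of "Min (insert 0 (c ` T))"])
    fix u assume "u \<in> K"
    then obtain a where "a \<in> T" "u \<in> S a"
      using T(2) by blast
    then have "Min (insert 0 (c ` T)) \<le> c a"
      using T(1) by (intro Min_le) auto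
    then show "ereal (Min (insert 0 (c ` T))) \<le> h u"
      using S(3)[OF \<open>u \<in> S a\<close>] by (meson ereal_less_eq(3) less_imp_le order_trans)
  qed
qed

text \<open>Expanding the squares in the minimality inequality bounds the difference quotient below
  by \<open>- (norm (y - a) / (2 * \<gamma>))\<close>, which tends to 0.\<close>

lemma argmin_prox_in_frechet_subdiff:
  fixes h :: "'a::real_inner \<Rightarrow> ereal"
  assumes \<gamma>: "\<gamma> > 0" and fin: "\<bar>h a\<bar> \<noteq> \<infinity>"
    and a: "a \<in> argmin (\<lambda>u. h u + ereal (1 / (2 * \<gamma>) * (norm (u - c))\<^sup>2))"
  shows "(1 / \<gamma>) *\<^sub>R (c - a) \<in> frechet_subdiff h a"
proof -
  define v where "v = (1 / \<gamma>) *\<^sub>R (c - a)"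
  obtain H where H: "h a = ereal H"
    using fin by auto
  have "ereal (- (norm (y - a) / (2 * \<gamma>)))
      \<le> (h y - h a - ereal (inner v (y - a))) / ereal (norm (y - a))" if "y \<noteq> a" for y
  proof -
    have *: "h a + ereal (1 / (2 * \<gamma>) * (norm (a - c))\<^sup>2) \<le> h y + ereal (1 / (2 * \<gamma>) * (norm (y - c))\<^sup>2)"
      using a by (auto simp: argmin_def)
    show ?thesis
    proof (cases "h y")
      case (real r)
      have "H + 1 / (2 * \<gamma>) * (norm (a - c))\<^sup>2 \<le> r + 1 / (2 * \<gamma>) * (norm (y - c))\<^sup>2"
        using * by (simp add: H real)
      moreover have "1 / (2 * \<gamma>) * (norm (y - c))\<^sup>2 - 1 / (2 * \<gamma>) * (norm (a - c))\<^sup>2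
          = 1 / (2 * \<gamma>) * (norm (y - a))\<^sup>2 - inner v (y - a)"
        using \<gamma> by (simp add: v_def power2_norm_eq_inner inner_simps inner_commute field_simps)
      ultimately have "- (1 / (2 * \<gamma>) * (norm (y - a))\<^sup>2) \<le> r - H - inner v (y - a)"
        by simp
      then have "- (norm (y - a) / (2 * \<gamma>)) * norm (y - a) \<le> r - H - inner v (y - a)"
        by (simp add: power2_eq_square)
      then have "- (norm (y - a) / (2 * \<gamma>)) \<le> (r - H - inner v (y - a)) / norm (y - a)"
        using that by (subst pos_le_divide_eq) auto
      then show ?thesis
        using that by (simp add: H real)
    next
      case PInf
      then show ?thesis
        using that by (simp add: H)
    next
      case MInf
      then show ?thesis
        using * by (simp add: H)
    qed
  qed
  then have "Liminf (at a) (\<lambda>y. ereal (- (norm (y - a) / (2 * \<gamma>))))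
      \<le> Liminf (at a) (\<lambda>y. (h y - h a - ereal (inner v (y - a))) / ereal (norm (y - a)))"
    by (intro Liminf_mono) (auto simp: eventually_at_filter)
  moreover have "0 \<le> Liminf (at a) (\<lambda>y. ereal (- (norm (y - a) / (2 * \<gamma>))))"
  \<comment> \<open>In a one-point space the punctured filter is trivial and the lower limit is
    infinite.\<close>
  proof (cases "at a = bot")
    case False
    have "((\<lambda>y. ereal (- (norm (y - a) / (2 * \<gamma>)))) \<longlongrightarrow> ereal (- (norm (a - a) / (2 * \<gamma>)))) (at a)"
      using \<gamma> by (intro tendsto_intros) auto
    from lim_imp_Liminf[OF False this] show ?thesis
      by simp
  qed (simp add: Liminf_bot)
  ultimately show ?thesis
    using fin by (auto simp: frechet_subdiff_def v_def)
qed

text \<open>A level strictly between \<open>a\<close> and a larger \<open>h l\<close> would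
  eventually lie both below and above \<open>h (u k)\<close>.\<close>

lemma lsc_le_limit:
  fixes a :: real
  assumes "lsc h" "u \<longlonglongrightarrow> l" "\<And>k. h (u k) = ereal (s k)" "s \<longlonglongrightarrow> a"
  shows "h l \<le> ereal a"
proof (rule ccontr)
  assume "\<not> h l \<le> ereal a"
  then obtain c where c: "ereal a < ereal c" "ereal c < h l"
    using ereal_dense2[of "ereal a" "h l"] by (auto simp: not_le)
  have "\<forall>\<^sub>F k in sequentially. ereal c < h (u k)"
    by (rule lsc_eventually_gt[OF assms(1) c(2) assms(2)])
  moreover have "\<forall>\<^sub>F k in sequentially. s k < c"
    using order_tendstoD(2)[OF assms(4)] c(1) by simp
  ultimately have "\<forall>\<^sub>F k in sequentially. False"
    by eventually_elim (simp add: assms(3))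
  then show False
    by simp
qed

subsection \<open>Null sequences\<close>

lemma tendsto_zero_of_square_bound:
  fixes a e :: "nat \<Rightarrow> real"
  assumes "c > 0" "\<And>n. c * (a n)\<^sup>2 \<le> e n" "e \<longlonglongrightarrow> 0"
  shows "a \<longlonglongrightarrow> 0"
proof -
  have "(\<lambda>n. e n / c) \<longlonglongrightarrow> 0"
    using tendsto_divide[OF assms(3) tendsto_const[of c]] assms(1) by simp
  then have "(\<lambda>n. (a n)\<^sup>2) \<longlonglongrightarrow> 0"
    by (rule tendsto_sandwich[rotated -1]) (use assms(1,2) in \<open>auto simp: field_simps\<close>)
  from tendsto_real_sqrt[OF this] show ?thesis
    by (simp add: tendsto_rabs_zero_iff)
qed

lemma bounded_range_Suc:
  fixes u :: "nat \<Rightarrow> 'a::metric_space"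
  assumes "bounded (range (\<lambda>n. u (Suc n)))"
  shows "bounded (range u)"
proof (rule bounded_subset)
  show "bounded (insert (u 0) (range (\<lambda>n. u (Suc n))))"
    using assms by simp
  show "range u \<subseteq> insert (u 0) (range (\<lambda>n. u (Suc n)))"
  proof clarify
    fix n assume "u n \<notin> range (\<lambda>n. u (Suc n))"
    then show "u n = u 0"
      by (cases n) auto
  qed
qed

lemma bounded_range_if_diff_null:
  fixes u v :: "nat \<Rightarrow> 'a::real_normed_vector"
  assumes "bounded (range u)" "(\<lambda>n. v n - u n) \<longlonglongrightarrow> 0"
  shows "bounded (range v)"
proof -
  have "bounded (range (\<lambda>n. u n + (v n - u n)))"
    using assms(1) convergent_imp_bounded[OF assms(2)] by (rule bounded_plus_comp)
  then show ?thesis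
    by simp
qed

lemma inner_null_if_bounded:
  fixes u v :: "nat \<Rightarrow> 'a::real_inner"
  assumes "bounded (range u)" "v \<longlonglongrightarrow> 0"
  shows "(\<lambda>n. inner (u n) (v n)) \<longlonglongrightarrow> 0"
proof -
  obtain C where C: "\<And>n. norm (u n) \<le> C"
    using assms(1) by (auto simp: bounded_iff)
  have lim: "(\<lambda>n. C * norm (v n)) \<longlonglongrightarrow> 0"
    using tendsto_mult_left[OF tendsto_norm[OF assms(2)], of C] by simp
  have "norm (inner (u n) (v n)) \<le> C * norm (v n)" for n
    using Cauchy_Schwarz_ineq2[of "u n" "v n"] mult_right_mono[OF C[of n], of "norm (v n)"]
    by simp
  then show ?thesis
    by (intro Lim_null_comparison[OF always_eventually lim] allI)
qed

text \<open>Neither sequence need converge: both stay in a compact ball, where \<open>\<phi>\<close>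
  is uniformly continuous.\<close>

lemma continuous_diff_null_if_bounded:
  fixes \<phi> :: "'a::euclidean_space \<Rightarrow> real"
  assumes "continuous_on UNIV \<phi>" "bounded (range u)" "(\<lambda>n. v n - u n) \<longlonglongrightarrow> 0"
  shows "(\<lambda>n. \<phi> (v n) - \<phi> (u n)) \<longlonglongrightarrow> 0"
proof -
  have "bounded (range u \<union> range v)"
    using assms bounded_range_if_diff_null by auto
  then obtain R where R: "\<forall>s \<in> range u \<union> range v. norm s \<le> R"
    unfolding bounded_iff ..
  have "uniformly_continuous_on (cball 0 R) \<phi>"
    using assms(1) by (intro compact_uniformly_continuous) (auto intro: continuous_on_subset)
  moreover have "(\<lambda>n. dist (v n) (u n)) \<longlonglongrightarrow> 0"
    using tendsto_norm[OF assms(3)] by (simp add: dist_norm)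
  moreover have "u n \<in> cball 0 R" "v n \<in> cball 0 R" for n
    using R by auto
  ultimately have "(\<lambda>n. dist (\<phi> (v n)) (\<phi> (u n))) \<longlonglongrightarrow> 0"
    unfolding uniformly_continuous_on_sequentially by blast
  then show ?thesis
    by (simp add: dist_real_def tendsto_rabs_zero_iff)
qed

subsection \<open>The algorithm\<close>

text \<open>The steps leave \<open>x 0\<close> free, and \<open>h\<close> at \<open>z 0\<close> or
  the conjugate at \<open>w 0\<close> may be infinite; hence the estimates below are stated at
  \<open>Suc n\<close>.\<close>

locale backward_douglas_rachford =
  fixes f g :: "'a::euclidean_space \<Rightarrow> real"
    and gradf :: "'a \<Rightarrow> 'a"
    and h :: "'a \<Rightarrow> ereal"
    and \<rho> L \<gamma> \<tau> \<nu> :: real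
    and x y z w :: "nat \<Rightarrow> 'a"
  assumes f_grad: "\<And>u. (f has_derivative (\<lambda>v. inner (gradf u) v)) (at u)"
    and f_wc: "weakly_convex \<rho> f" and rho: "\<rho> \<ge> 0"
    and grad_lip: "L-lipschitz_on UNIV gradf"
    and g_cont: "continuous_on UNIV g" and g_cvx: "convex_on UNIV g"
    and h_nm: "\<And>u. h u \<noteq> -\<infinity>" and h_proper: "\<exists>u. h u \<noteq> \<infinity>"
    and h_lsc: "lsc h"
    and gamma: "\<gamma> > 0" and tau: "\<tau> \<ge> 0" and nu: "0 < \<nu>" "\<nu> < 2"
    and gamma_bar: "L = 0 \<or>
        \<gamma> < (- \<nu> * \<rho> + sqrt (\<nu>\<^sup>2 * \<rho>\<^sup>2 + 8 * (2 - \<nu>) * L\<^sup>2)) / (4 * L\<^sup>2)"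
    and x_step: "\<And>n. x (Suc n) \<in> argmin (\<lambda>u. ereal (f u + 1 / (2 * \<gamma>) * (norm (u - y n))\<^sup>2))"
    and w_step: "\<And>n. w (Suc n) \<in> argmin (\<lambda>u. fconj g u
                     + ereal (- inner u (z n) + \<tau> / 2 * (norm (u - w n))\<^sup>2))"
    and z_step: "\<And>n. z (Suc n) \<in> argmin (\<lambda>u. h u
                     + ereal (1 / (2 * \<gamma>) *
                         (norm (u - (2 *\<^sub>R x (Suc n) - y n + \<gamma> *\<^sub>R w (Suc n))))\<^sup>2))"
    and y_step: "\<And>n. y (Suc n) = y n + \<nu> *\<^sub>R (z (Suc n) - x (Suc n))"
begin

section \<open>Constants and the step-size condition\<close>

lemma L_nonneg: "0 \<le> L"
  using grad_lip by (rule lipschitz_on_nonneg)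

lemma gradf_lipschitz: "norm (gradf u - gradf v) \<le> L * norm (u - v)"
  using lipschitz_onD[OF grad_lip] by (simp add: dist_norm)

text \<open>When \<open>L = 0\<close> the step size \<open>\<gamma>\<close> is unconstrained, so \<open>\<delta>\<close> may be negative. In that case \<open>f\<close> is
  affine, and the modulus of weak convexity may be taken to be \<open>0\<close>.\<close>

definition modulus :: real where
  "modulus = (if L = 0 then 0 else \<rho>)"

text \<open>The constant \<open>\<delta>\<close> of the theorem with \<open>modulus\<close> in place
  of \<open>\<rho>\<close>; the two agree unless \<open>L = 0\<close>.\<close>

definition rate :: real where
  "rate = (2 - \<nu> - \<nu> * modulus * \<gamma> - 2 * L\<^sup>2 * \<gamma>\<^sup>2) / (\<nu> * \<gamma>)"

text \<open>For nonzero \<open>L\<close> the bound on \<gamma> is the positive root of this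
  quadratic; isolating the square root and squaring recovers its sign.\<close>

lemma rate_numerator_pos: "0 < 2 - \<nu> - \<nu> * modulus * \<gamma> - 2 * L\<^sup>2 * \<gamma>\<^sup>2"
proof (cases "L = 0")
  case False
  define D where "D = \<nu>\<^sup>2 * \<rho>\<^sup>2 + 8 * (2 - \<nu>) * L\<^sup>2"
  have L2: "L\<^sup>2 > 0"
    using False by simp
  have "\<gamma> * (4 * L\<^sup>2) < - \<nu> * \<rho> + sqrt D"
    using gamma_bar False L2 by (simp add: pos_less_divide_eq D_def)
  then have "(\<gamma> * (4 * L\<^sup>2) + \<nu> * \<rho>)\<^sup>2 < (sqrt D)\<^sup>2"
    using gamma nu rho by (intro power_strict_mono) auto
  moreover have "D \<ge> 0"
    using nu by (simp add: D_def)
  ultimately have "(\<gamma> * (4 * L\<^sup>2) + \<nu> * \<rho>)\<^sup>2 < D"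
    by simp
  then have "8 * L\<^sup>2 * (2 * L\<^sup>2 * \<gamma>\<^sup>2 + \<nu> * \<rho> * \<gamma>) < 8 * L\<^sup>2 * (2 - \<nu>)"
    by (simp add: D_def power2_eq_square algebra_simps)
  then show ?thesis
    using L2 False by (simp add: modulus_def)
next
  case True
  then have "modulus = 0"
    unfolding modulus_def by simp
  with True show ?thesis
    using nu by simp
qed

lemma rate_pos: "0 < rate"
  unfolding rate_def using rate_numerator_pos gamma nu by simp

lemma rate_ge: "(2 - \<nu> - \<nu> * \<rho> * \<gamma> - 2 * L\<^sup>2 * \<gamma>\<^sup>2) / (\<nu> * \<gamma>) \<le> rate"
  unfolding rate_def using gamma nu rho by (intro divide_right_mono) (auto simp: modulus_def)

text \<open>Positivity of the numerator of \<open>rate\<close> gives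
  \<open>2 * (L * \<gamma>)\<^sup>2 < 2 - \<nu> < 2\<close>.\<close>

lemma L_gamma_less_1: "L * \<gamma> < 1"
proof -
  have "0 \<le> \<nu> * modulus * \<gamma>"
    using nu rho gamma by (simp add: modulus_def)
  then have "(L * \<gamma>)\<^sup>2 < 1\<^sup>2"
    using rate_numerator_pos nu by (simp add: power_mult_distrib)
  then show ?thesis
    by (rule power_less_imp_less_base) simp
qed

lemma f_above_tangent:
  "f u + inner (gradf u) (v - u) - modulus / 2 * (norm (v - u))\<^sup>2 \<le> f v"
proof (cases "L = 0")
  case True
  have "gradf (v + t) = gradf u" for t
    using gradf_lipschitz[of "v + t" u] True by simp
  then have eq: "gradf v = gradf u"
    by (metis add.right_neutral)
  \<comment> \<open>The upper bound based at \<open>v\<close> becomes the lower bound based at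
    \<open>u\<close>, because the gradient is constant.\<close>
  have "f u \<le> f v + inner (gradf v) (u - v) + L / 2 * (norm (u - v))\<^sup>2"
    by (rule lipschitz_gradient_upper_bound[OF f_grad grad_lip])
  moreover have "modulus = 0"
    unfolding modulus_def using True by simp
  ultimately show ?thesis
    using True eq by (simp add: inner_simps)
next
  case False
  then show ?thesis
    using weakly_convex_above_tangent[where G = gradf, OF f_wc f_grad] by (simp add: modulus_def)
qed

section \<open>Optimality conditions and finiteness of the values along the iterates\<close>

text \<open>Fermat's rule for the differentiable \<open>x\<close>-subproblem.\<close>

lemma y_eq: "y n = x (Suc n) + \<gamma> *\<^sub>R gradf (x (Suc n))"
proof -
  define a where "a = x (Suc n)"
  define \<phi> where "\<phi> u = f u + 1 / (2 * \<gamma>) * inner (u - y n) (u - y n)" for u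
  have "(\<phi> has_derivative (\<lambda>v. inner (gradf a + (1 / \<gamma>) *\<^sub>R (a - y n)) v)) (at a)"
    unfolding \<phi>_def using gamma
    by (auto intro!: derivative_eq_intros f_grad simp: fun_eq_iff inner_simps inner_commute field_simps)
  moreover have "\<forall>\<^sub>F u in at a. \<phi> a \<le> \<phi> u"
    using x_step[of n] by (simp add: argmin_def \<phi>_def a_def power2_norm_eq_inner)
  ultimately have "(\<lambda>v. inner (gradf a + (1 / \<gamma>) *\<^sub>R (a - y n)) v) = (\<lambda>v. 0)"
    by (rule has_derivative_local_min)
  then have "gradf a + (1 / \<gamma>) *\<^sub>R (a - y n) = 0"
    by (metis inner_eq_zero_iff)
  then have "\<gamma> *\<^sub>R (gradf a + (1 / \<gamma>) *\<^sub>R (a - y n)) = 0"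
    by simp
  then show ?thesis
    using gamma by (simp add: a_def scaleR_add_right algebra_simps)
qed

text \<open>The point at which the new \<open>w\<close> is a subgradient of \<open>g\<close>:
  \<open>z n\<close> shifted by the proximal term of the \<open>w\<close>-step.\<close>

definition p where "p n = z n - \<tau> *\<^sub>R (w (Suc n) - w n)"

lemma w_in_cvx_subdiff: "w (Suc n) \<in> cvx_subdiff g (p n)"
  unfolding p_def by (rule argmin_fconj_prox_in_cvx_subdiff[OF g_cvx w_step])

text \<open>Real values allow linear arithmetic. \<open>real_of_ereal\<close> sends infinities to 0,
  so only indices from 1 on, where finiteness is proved, are meaningful.\<close>

definition G where "G n = real_of_ereal (fconj g (w n))"
definition H where "H n = real_of_ereal (h (z n))"

lemma G_Suc: "G (Suc n) = inner (w (Suc n)) (p n) - g (p n)"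
  unfolding G_def by (simp add: fconj_eq_on_cvx_subdiff[OF w_in_cvx_subdiff])

lemma fconj_w: "fconj g (w (Suc n)) = ereal (G (Suc n))"
  unfolding G_def by (simp add: fconj_eq_on_cvx_subdiff[OF w_in_cvx_subdiff])

text \<open>An infinite value would lose against any point where \<open>h\<close> is finite.\<close>

lemma h_z: "h (z (Suc n)) = ereal (H (Suc n))"
proof -
  obtain u where u: "h u \<noteq> \<infinity>"
    using h_proper by blast
  have "h (z (Suc n)) \<noteq> \<infinity>"
    using z_step[of n] u by (auto simp: argmin_def dest: spec[of _ u])
  then show ?thesis
    unfolding H_def using h_nm[of "z (Suc n)"] by (cases "h (z (Suc n))") auto
qed

definition merit where
  "merit n = f (x n) + H n + G n - inner (w n) (z n) + 1 / (2 * \<gamma>) * (norm (x n - y n))\<^sup>2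
     - 1 / (2 * \<gamma>) * (norm (y n - z n))\<^sup>2 + (1 - \<nu>) / \<gamma> * (norm (x n - z n))\<^sup>2"

lemma bdr_merit_eq: "bdr_merit f h g \<gamma> \<nu> (x (Suc n)) (y (Suc n)) (z (Suc n)) (w (Suc n)) = ereal (merit (Suc n))"
  unfolding bdr_merit_def h_z fconj_w merit_def by simp

section \<open>Change of the merit function under each update\<close>

lemma w_step_decrease:
  "G (Suc (Suc n)) - inner (w (Suc (Suc n))) (z (Suc n))
     + \<tau> / 2 * (norm (w (Suc (Suc n)) - w (Suc n)))\<^sup>2
   \<le> G (Suc n) - inner (w (Suc n)) (z (Suc n))"
  using w_step[of "Suc n"] unfolding argmin_def
  by (auto simp: fconj_w dest!: spec[of _ "w (Suc n)"])

text \<open>Up to a constant in \<open>u\<close>, the penalty of the \<open>z\<close>-step consists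
  of merit terms, but with weight \<open>1 / \<gamma>\<close> instead of
  \<open>(1 - \<nu>) / \<gamma>\<close> on the squared distance to \<open>a\<close>.\<close>

lemma prox_expansion:
  "1 / (2 * \<gamma>) * (norm (u - (2 *\<^sub>R a - b + \<gamma> *\<^sub>R c)))\<^sup>2 =
     1 / \<gamma> * (norm (a - u))\<^sup>2 - 1 / (2 * \<gamma>) * (norm (b - u))\<^sup>2 - inner c u
     + (1 / \<gamma> * (norm (a - b))\<^sup>2 + inner c (2 *\<^sub>R a - b) + \<gamma> / 2 * (norm c)\<^sup>2)"
  using gamma unfolding power2_norm_eq_inner
  by (simp add: inner_simps inner_commute field_simps)

lemma z_step_decrease:
  "H (Suc (Suc n)) + 1 / \<gamma> * (norm (x (Suc (Suc n)) - z (Suc (Suc n))))\<^sup>2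
     - 1 / (2 * \<gamma>) * (norm (y (Suc n) - z (Suc (Suc n))))\<^sup>2 - inner (w (Suc (Suc n))) (z (Suc (Suc n)))
   \<le> H (Suc n) + 1 / \<gamma> * (norm (x (Suc (Suc n)) - z (Suc n)))\<^sup>2
     - 1 / (2 * \<gamma>) * (norm (y (Suc n) - z (Suc n)))\<^sup>2 - inner (w (Suc (Suc n))) (z (Suc n))"
  using z_step[of "Suc n"] unfolding argmin_def prox_expansion
  by (auto simp: h_z dest!: spec[of _ "z (Suc n)"])

text \<open>Explains the weight \<open>(1 - \<nu>) / \<gamma>\<close> in the merit function: after
  the \<open>y\<close>-update it yields the same quadratic part as weight
  \<open>1 / \<gamma>\<close> before it.\<close>

lemma y_step_identity:
  fixes a b b' c :: 'a
  assumes "b' = b + \<nu> *\<^sub>R (c - a)"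
  shows "1 / (2 * \<gamma>) * (norm (a - b'))\<^sup>2 - 1 / (2 * \<gamma>) * (norm (b' - c))\<^sup>2 + (1 - \<nu>) / \<gamma> * (norm (a - c))\<^sup>2
    = 1 / (2 * \<gamma>) * (norm (a - b))\<^sup>2 - 1 / (2 * \<gamma>) * (norm (b - c))\<^sup>2 + 1 / \<gamma> * (norm (a - c))\<^sup>2"
  using gamma unfolding power2_norm_eq_inner assms
  by (simp add: inner_simps inner_commute field_simps)

text \<open>Here \<open>a\<close>, \<open>a'\<close> are the old and new \<open>x\<close>,
  \<open>d\<close>, \<open>d'\<close> the gradients there, \<open>b\<close> is \<open>y\<close> and
  \<open>c\<close> is \<open>z\<close>. The hypotheses eliminate \<open>b\<close> and
  \<open>c\<close> in favour of the increments.\<close>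

lemma x_step_identity:
  assumes "b = a' + \<gamma> *\<^sub>R d'" and "\<nu> *\<^sub>R (c - a) = a' - a + \<gamma> *\<^sub>R (d' - d)"
  shows "1 / (2 * \<gamma>) * (norm (a' - b))\<^sup>2 + 1 / \<gamma> * (norm (a' - c))\<^sup>2
    = 1 / (2 * \<gamma>) * (norm (a - b))\<^sup>2 + (1 - \<nu>) / \<gamma> * (norm (a - c))\<^sup>2
      - inner d' (a' - a) + (1 / (2 * \<gamma>) - 1 / (\<nu> * \<gamma>)) * (norm (a' - a))\<^sup>2
      + \<gamma> / \<nu> * (norm (d' - d))\<^sup>2"
proof -
  define s where "s = (1 / \<nu>) *\<^sub>R (a' - a + \<gamma> *\<^sub>R (d' - d))"
  define \<alpha> \<beta> where "\<alpha> = a' - a" and "\<beta> = d' - d"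
  have s: "c = a + s" "s = (1 / \<nu>) *\<^sub>R (\<alpha> + \<gamma> *\<^sub>R \<beta>)"
    unfolding s_def \<alpha>_def \<beta>_def assms(2)[symmetric] using nu by auto
  have a': "a' = a + \<alpha>" "d' - d = \<beta>"
    by (auto simp: \<alpha>_def \<beta>_def)
  have 1: "1 / (2 * \<gamma>) * (norm (a' - b))\<^sup>2 =
      1 / (2 * \<gamma>) * (norm (a - b))\<^sup>2 - inner d' \<alpha> - 1 / (2 * \<gamma>) * (norm \<alpha>)\<^sup>2"
    using gamma unfolding power2_norm_eq_inner assms(1) a'
    by (simp add: inner_simps inner_commute field_simps)
  \<comment> \<open>The cross terms in \<alpha> and \<beta> cancel when the two squares are
    subtracted.\<close>
  have 2: "1 / \<gamma> * (norm (a' - c))\<^sup>2 = (1 - \<nu>) / \<gamma> * (norm (a - c))\<^sup>2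
      + (1 / \<gamma> - 1 / (\<nu> * \<gamma>)) * (norm \<alpha>)\<^sup>2 + \<gamma> / \<nu> * (norm \<beta>)\<^sup>2"
    using gamma nu unfolding power2_norm_eq_inner a' s
    by (simp add: inner_simps inner_commute field_simps power2_eq_square)
  have "(1 / \<gamma> - 1 / (\<nu> * \<gamma>)) * (norm \<alpha>)\<^sup>2 - 1 / (2 * \<gamma>) * (norm \<alpha>)\<^sup>2
      = (1 / (2 * \<gamma>) - 1 / (\<nu> * \<gamma>)) * (norm \<alpha>)\<^sup>2"
    using gamma nu by (simp add: field_simps)
  with 1 2 show ?thesis
    unfolding \<alpha>_def \<beta>_def by linarith
qed

lemma z_minus_x: "\<nu> *\<^sub>R (z (Suc n) - x (Suc n)) =
    x (Suc (Suc n)) - x (Suc n) + \<gamma> *\<^sub>R (gradf (x (Suc (Suc n))) - gradf (x (Suc n)))"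
  using y_step[of n] y_eq[of n] y_eq[of "Suc n"] by (simp add: algebra_simps)

lemma merit_decrease:
  "merit (Suc (Suc n)) + (rate / 2 * (norm (x (Suc (Suc n)) - x (Suc n)))\<^sup>2
     + \<tau> / 2 * (norm (w (Suc (Suc n)) - w (Suc n)))\<^sup>2) \<le> merit (Suc n)"
proof -
  define X X' where "X = x (Suc n)" and "X' = x (Suc (Suc n))"
  have "(norm (gradf X' - gradf X))\<^sup>2 \<le> (L * norm (X' - X))\<^sup>2"
    using gradf_lipschitz by (intro power_mono) auto
  then have "\<gamma> / \<nu> * (norm (gradf X' - gradf X))\<^sup>2 \<le> \<gamma> / \<nu> * (L * norm (X' - X))\<^sup>2"
    using gamma nu by (intro mult_left_mono) auto
  \<comment> \<open>This balance determines \<open>rate\<close>; the \<open>modulus\<close> term is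
    then used up by the tangent inequality for \<open>f\<close>.\<close>
  moreover have "(1 / (2 * \<gamma>) - 1 / (\<nu> * \<gamma>)) * (norm (X' - X))\<^sup>2 + \<gamma> / \<nu> * (L * norm (X' - X))\<^sup>2
      = - (rate / 2 * (norm (X' - X))\<^sup>2) - modulus / 2 * (norm (X' - X))\<^sup>2"
    using gamma nu by (simp add: rate_def field_simps power2_eq_square)
  moreover have "f X' + inner (gradf X') (X - X') - modulus / 2 * (norm (X' - X))\<^sup>2 \<le> f X"
    using f_above_tangent[of X' X] by (simp add: norm_minus_commute)
  moreover have "inner (gradf X') (X - X') = - inner (gradf X') (X' - X)"
    by (simp add: inner_simps)
  ultimately show ?thesis
    using w_step_decrease[of n] z_step_decrease[of n] y_step_identity[OF y_step[of "Suc n"]]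
      x_step_identity[OF y_eq[of "Suc n"] z_minus_x[of n]]
    unfolding merit_def X_def X'_def by linarith
qed

section \<open>Comparison of the merit function with the objective\<close>

definition obj where "obj n = f (z n) + H n - g (z n)"

text \<open>Fenchel-Young handles \<open>g\<close> and the quadratic upper bound handles
  \<open>f\<close>; inserting the formula for \<open>y\<close>, the quadratic terms collapse to an
  expression free of \<nu>.\<close>

lemma merit_ge: "obj (Suc n) + (1 / (2 * \<gamma>) - L / 2) * (norm (z (Suc n) - x (Suc n)))\<^sup>2 \<le> merit (Suc n)"
proof -
  define X Y Z W where "X = x (Suc n)" and "Y = y (Suc n)" and "Z = z (Suc n)" and "W = w (Suc n)"
  define s where "s = Z - X"
  have Z: "Z = X + s"
    by (simp add: s_def)
  have Y: "Y = X + (\<gamma> *\<^sub>R gradf X + \<nu> *\<^sub>R s)"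
    using y_step[of n] y_eq[of n] by (simp add: X_def Y_def Z_def s_def)
  have "inner W Z - g Z \<le> G (Suc n)"
    using fconj_ge[of W Z g] by (simp add: W_def fconj_w)
  moreover have "f Z \<le> f X + inner (gradf X) s + L / 2 * (norm s)\<^sup>2"
    using lipschitz_gradient_upper_bound[OF f_grad grad_lip, of Z X] by (simp add: s_def)
  moreover have "1 / (2 * \<gamma>) * (norm (X - Y))\<^sup>2 - 1 / (2 * \<gamma>) * (norm (Y - Z))\<^sup>2
      + (1 - \<nu>) / \<gamma> * (norm (X - Z))\<^sup>2 = inner (gradf X) s + 1 / (2 * \<gamma>) * (norm s)\<^sup>2"
    unfolding power2_norm_eq_inner Y Z using gamma
    by (simp add: inner_simps inner_commute field_simps power2_eq_square)
  ultimately show ?thesis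
    unfolding merit_def obj_def X_def[symmetric] Y_def[symmetric] Z_def[symmetric] W_def[symmetric]
      s_def[symmetric]
    by (simp add: algebra_simps)
qed

definition objective where "objective u = ereal (f u) + h u - ereal (g u)"

lemma objective_z: "objective (z (Suc n)) = ereal (obj (Suc n))"
  by (simp add: objective_def h_z obj_def)

lemma f_cont: "continuous_on UNIV f"
  using f_grad by (meson continuous_at_imp_continuous_on has_derivative_continuous)

lemma gradf_cont: "continuous_on UNIV gradf"
  using grad_lip by (rule lipschitz_on_continuous_on)

lemma merit_decseq: "decseq (\<lambda>n. merit (Suc n))"
proof (rule decseq_SucI)
  fix n
  have "0 \<le> rate / 2 * (norm (x (Suc (Suc n)) - x (Suc n)))\<^sup>2
     + \<tau> / 2 * (norm (w (Suc (Suc n)) - w (Suc n)))\<^sup>2"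
    using rate_pos tau by simp
  then show "merit (Suc (Suc n)) \<le> merit (Suc n)"
    using merit_decrease[of n] by linarith
qed

lemma obj_le_merit: "obj (Suc n) \<le> merit (Suc n)"
proof -
  have "0 \<le> 1 / (2 * \<gamma>) - L / 2"
    using gamma L_gamma_less_1 by (simp add: field_simps)
  then have "0 \<le> (1 / (2 * \<gamma>) - L / 2) * (norm (z (Suc n) - x (Suc n)))\<^sup>2"
    by simp
  then show ?thesis
    using merit_ge[of n] by linarith
qed

section \<open>Boundedness and vanishing increments under coercivity\<close>

context
  assumes objective_coercive: "coercive objective"
begin

text \<open>From index 1 on, \<open>z\<close> stays in the sublevel set of the objective at height
  \<open>merit 1\<close>.\<close>

lemma z_bounded: "bounded (range z)"
proof (rule bounded_range_Suc)
  have "\<forall>\<^sub>F u in at_infinity. ereal (merit 1) < objective u"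
    using objective_coercive unfolding coercive_def by (intro order_tendstoD) auto
  then obtain R where R: "\<And>u. R \<le> norm u \<Longrightarrow> ereal (merit 1) < objective u"
    by (auto simp: eventually_at_infinity)
  have "norm (z (Suc n)) \<le> R" for n
  proof (rule ccontr)
    assume "\<not> norm (z (Suc n)) \<le> R"
    then have "merit 1 < obj (Suc n)"
      using R[of "z (Suc n)"] by (simp add: objective_z)
    then show False
      using obj_le_merit[of n] decseqD[OF merit_decseq, of 0 n] by simp
  qed
  then show "bounded (range (\<lambda>n. z (Suc n)))"
    by (auto simp: bounded_iff)
qed

lemma obj_bounded_below: "\<exists>c. \<forall>n. c \<le> obj (Suc n)"
proof -
  obtain R where R: "\<forall>s \<in> range z. norm s \<le> R"
    using z_bounded unfolding bounded_iff ..
  obtain c where c: "\<And>u. u \<in> cball 0 R \<Longrightarrow> ereal c \<le> h u"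
    using lsc_bounded_below_on_compact[OF h_lsc h_nm compact_cball] by metis
  have "bounded ((\<lambda>u. f u - g u) ` cball 0 R)"
    by (intro compact_imp_bounded compact_continuous_image continuous_on_diff
        continuous_on_subset[OF f_cont] continuous_on_subset[OF g_cont]) auto
  then obtain K where K: "\<And>u. u \<in> cball 0 R \<Longrightarrow> \<bar>f u - g u\<bar> \<le> K"
    unfolding bounded_iff by (metis imageI real_norm_def)
  have "c - K \<le> obj (Suc n)" for n
  proof -
    have "z (Suc n) \<in> cball 0 R"
      using R by simp
    from c[OF this] K[OF this] show ?thesis
      by (simp add: h_z obj_def)
  qed
  then show ?thesis
    by blast
qed

lemma merit_convergent: "\<exists>m. (\<lambda>n. merit (Suc n)) \<longlonglongrightarrow> m"
proof -
  obtain c where "\<And>n. c \<le> obj (Suc n)"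
    using obj_bounded_below by blast
  then have "\<forall>n. c \<le> merit (Suc n)"
    using obj_le_merit order_trans by blast
  from decseq_convergent[OF merit_decseq this] show ?thesis
    by metis
qed

lemma merit_diff_null: "(\<lambda>n. merit (Suc n) - merit (Suc (Suc n))) \<longlonglongrightarrow> 0"
proof -
  obtain m where m: "(\<lambda>n. merit (Suc n)) \<longlonglongrightarrow> m"
    using merit_convergent by blast
  from tendsto_diff[OF m LIMSEQ_Suc[OF m]] show ?thesis
    by simp
qed

lemma x_diff_null: "(\<lambda>n. x (Suc n) - x n) \<longlonglongrightarrow> 0"
proof -
  have "rate / 2 * (norm (x (Suc (Suc n)) - x (Suc n)))\<^sup>2 \<le> merit (Suc n) - merit (Suc (Suc n))" for n
  proof -
    have "0 \<le> \<tau> / 2 * (norm (w (Suc (Suc n)) - w (Suc n)))\<^sup>2"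
      using tau by simp
    then show ?thesis
      using merit_decrease[of n] by linarith
  qed
  from tendsto_zero_of_square_bound[OF _ this merit_diff_null]
  have "(\<lambda>n. norm (x (Suc (Suc n)) - x (Suc n))) \<longlonglongrightarrow> 0"
    using rate_pos by simp
  \<comment> \<open>The decrease starts at index 1; dropping the shift adds one term, harmless for
    the limit.\<close>
  from LIMSEQ_imp_Suc[OF this] show ?thesis
    by (rule tendsto_norm_zero_cancel)
qed

lemma w_diff_null: "(\<lambda>n. \<tau> *\<^sub>R (w (Suc n) - w n)) \<longlonglongrightarrow> 0"
\<comment> \<open>For \<open>\<tau> = 0\<close> the descent estimate does not control
  \<open>w\<close>, but the scaled increment is zero.\<close>
proof (cases "\<tau> = 0")
  case False
  have "\<tau> / 2 * (norm (w (Suc (Suc n)) - w (Suc n)))\<^sup>2 \<le> merit (Suc n) - merit (Suc (Suc n))" for n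
  proof -
    have "0 \<le> rate / 2 * (norm (x (Suc (Suc n)) - x (Suc n)))\<^sup>2"
      using rate_pos by simp
    then show ?thesis
      using merit_decrease[of n] by linarith
  qed
  from tendsto_zero_of_square_bound[OF _ this merit_diff_null]
  have "(\<lambda>n. norm (w (Suc (Suc n)) - w (Suc n))) \<longlonglongrightarrow> 0"
    using False tau by simp
  from tendsto_norm_zero_cancel[OF LIMSEQ_imp_Suc[OF this]]
  show ?thesis
    by (rule tendsto_scaleR[OF tendsto_const, of _ 0, simplified])
qed simp

lemma y_diff_null: "(\<lambda>n. y (Suc n) - y n) \<longlonglongrightarrow> 0"
proof -
  have "(\<lambda>n. gradf (x (Suc n)) - gradf (x n)) \<longlonglongrightarrow> 0"
  proof (rule Lim_null_comparison)
    show "(\<lambda>n. L * norm (x (Suc n) - x n)) \<longlonglongrightarrow> 0"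
      using tendsto_mult_left[OF tendsto_norm_zero[OF x_diff_null], of L] by simp
  qed (simp add: gradf_lipschitz)
  then have "(\<lambda>n. (x (Suc n) - x n) + \<gamma> *\<^sub>R (gradf (x (Suc n)) - gradf (x n))) \<longlonglongrightarrow> 0 + \<gamma> *\<^sub>R 0"
    by (intro tendsto_intros x_diff_null)
  \<comment> \<open>A shift by one, since \<open>y n\<close> is a function of
    \<open>x (Suc n)\<close>.\<close>
  from LIMSEQ_Suc[OF this] show ?thesis
    by (simp add: y_eq algebra_simps)
qed

lemma z_minus_x_null: "(\<lambda>n. z (Suc n) - x (Suc n)) \<longlonglongrightarrow> 0"
proof -
  have "(\<lambda>n. (1 / \<nu>) *\<^sub>R (y (Suc n) - y n)) \<longlonglongrightarrow> (1 / \<nu>) *\<^sub>R 0"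
    by (intro tendsto_intros y_diff_null)
  then show ?thesis
    using nu by (simp add: y_step)
qed

lemma z_diff_null: "(\<lambda>n. z (Suc n) - z n) \<longlonglongrightarrow> 0"
proof -
  have "(\<lambda>n. (z (Suc (Suc n)) - x (Suc (Suc n))) + (x (Suc (Suc n)) - x (Suc n))
      - (z (Suc n) - x (Suc n))) \<longlonglongrightarrow> 0 + 0 - 0"
    by (intro tendsto_intros z_minus_x_null LIMSEQ_Suc[OF z_minus_x_null] LIMSEQ_Suc[OF x_diff_null])
  then have "(\<lambda>n. z (Suc (Suc n)) - z (Suc n)) \<longlonglongrightarrow> 0"
    by simp
  then show ?thesis
    by (rule LIMSEQ_imp_Suc)
qed

lemma p_minus_z_null: "(\<lambda>n. p n - z n) \<longlonglongrightarrow> 0"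
  using tendsto_minus[OF w_diff_null] by (simp add: p_def)

lemma x_bounded: "bounded (range x)"
proof (rule bounded_range_Suc, rule bounded_range_if_diff_null)
  show "bounded (range (\<lambda>n. z (Suc n)))"
    by (rule bounded_subset[OF z_bounded]) auto
  show "(\<lambda>n. x (Suc n) - z (Suc n)) \<longlonglongrightarrow> 0"
    using tendsto_minus[OF z_minus_x_null] by simp
qed

text \<open>A Lipschitz gradient grows at most linearly, so \<open>y_eq\<close> transfers the bound
  from \<open>x\<close>.\<close>

lemma y_bounded: "bounded (range y)"
proof -
  obtain R where R: "\<And>n. norm (x n) \<le> R"
    using x_bounded by (auto simp: bounded_iff)
  have "norm (y n) \<le> R + \<gamma> * (norm (gradf 0) + L * R)" for n
  proof -
    let ?x = "x (Suc n)"
    have "norm (gradf ?x) \<le> norm (gradf 0) + norm (gradf ?x - gradf 0)"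
      by (metis add.commute diff_add_cancel norm_triangle_ineq)
    also have "\<dots> \<le> norm (gradf 0) + L * R"
      using gradf_lipschitz[of ?x 0] mult_left_mono[OF R[of "Suc n"] L_nonneg] by simp
    finally have "\<gamma> * norm (gradf ?x) \<le> \<gamma> * (norm (gradf 0) + L * R)"
      using gamma by simp
    moreover have "norm (y n) \<le> norm ?x + \<gamma> * norm (gradf ?x)"
      using norm_triangle_ineq[of ?x "\<gamma> *\<^sub>R gradf ?x"] gamma by (simp add: y_eq)
    ultimately show ?thesis
      using R[of "Suc n"] by linarith
  qed
  then show ?thesis
    by (auto simp: bounded_iff)
qed

lemma p_bounded: "bounded (range p)"
  by (rule bounded_range_if_diff_null[OF z_bounded p_minus_z_null])

lemma w_bounded: "bounded (range w)"
proof (rule bounded_range_Suc)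
  obtain C where "\<And>u v. u \<in> range p \<Longrightarrow> v \<in> cvx_subdiff g u \<Longrightarrow> norm v \<le> C"
    using cvx_subdiff_bounded_on_bounded[OF g_cont p_bounded] by metis
  then have "norm (w (Suc n)) \<le> C" for n
    using w_in_cvx_subdiff by blast
  then show "bounded (range (\<lambda>n. w (Suc n)))"
    by (auto simp: bounded_iff)
qed

text \<open>By Fenchel equality at \<open>p n\<close>, every part of the gap is a difference of
  function values at asymptotically equal points or has a null factor.\<close>

lemma merit_minus_obj_null: "(\<lambda>n. merit (Suc n) - obj (Suc n)) \<longlonglongrightarrow> 0"
proof -
  have bdd: "bounded (range (\<lambda>n. u (Suc n)))" if "bounded (range u)" for u :: "nat \<Rightarrow> 'a"
    by (rule bounded_subset[OF that]) auto
  have xz: "(\<lambda>n. x (Suc n) - z (Suc n)) \<longlonglongrightarrow> 0"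
    using tendsto_minus[OF z_minus_x_null] by simp
  have pz: "(\<lambda>n. p n - z (Suc n)) \<longlonglongrightarrow> 0"
    using tendsto_diff[OF p_minus_z_null z_diff_null] by simp
  have 1: "(\<lambda>n. f (x (Suc n)) - f (z (Suc n))) \<longlonglongrightarrow> 0"
    by (rule continuous_diff_null_if_bounded[OF f_cont bdd[OF z_bounded] xz])
  have 2: "(\<lambda>n. g (p n) - g (z (Suc n))) \<longlonglongrightarrow> 0"
    by (rule continuous_diff_null_if_bounded[OF g_cont bdd[OF z_bounded] pz])
  have 3: "(\<lambda>n. inner (w (Suc n)) (p n - z (Suc n))) \<longlonglongrightarrow> 0"
    by (rule inner_null_if_bounded[OF bdd[OF w_bounded] pz])
  have "bounded (range (\<lambda>n. x n + z n - 2 *\<^sub>R y n))"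
    using x_bounded z_bounded y_bounded
    by (intro bounded_plus_comp bounded_minus_comp bounded_scaleR_comp)
  from inner_null_if_bounded[OF bdd[OF this] xz]
  have 4: "(\<lambda>n. inner (x (Suc n) + z (Suc n) - 2 *\<^sub>R y (Suc n)) (x (Suc n) - z (Suc n))) \<longlonglongrightarrow> 0" .
  have eq: "merit (Suc n) - obj (Suc n) =
      (f (x (Suc n)) - f (z (Suc n))) - (g (p n) - g (z (Suc n))) + inner (w (Suc n)) (p n - z (Suc n))
      + 1 / (2 * \<gamma>) * inner (x (Suc n) + z (Suc n) - 2 *\<^sub>R y (Suc n)) (x (Suc n) - z (Suc n))
      + (1 - \<nu>) / \<gamma> * (norm (x (Suc n) - z (Suc n)))\<^sup>2" for n
  \<comment> \<open>A difference of squares factors into a bounded vector times the null vector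
    \<open>x - z\<close>.\<close>
  proof -
    have "1 / (2 * \<gamma>) * (norm (a - b))\<^sup>2 - 1 / (2 * \<gamma>) * (norm (b - c))\<^sup>2
        = 1 / (2 * \<gamma>) * inner (a + c - 2 *\<^sub>R b) (a - c)" for a b c :: 'a
      using gamma unfolding power2_norm_eq_inner
      by (simp add: inner_simps inner_commute field_simps)
    from this[of "x (Suc n)" "y (Suc n)" "z (Suc n)"] show ?thesis
      unfolding merit_def obj_def G_Suc by (simp add: inner_diff_right)
  qed
  have "(\<lambda>n. merit (Suc n) - obj (Suc n)) \<longlonglongrightarrow>
      0 - 0 + 0 + 1 / (2 * \<gamma>) * 0 + (1 - \<nu>) / \<gamma> * (norm (0 :: 'a))\<^sup>2"
    unfolding eq by (intro tendsto_intros 1 2 3 4 xz)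
  then show ?thesis
    by simp
qed

section \<open>Identification of cluster points\<close>

lemma cluster_point:
  assumes r: "strict_mono r"
    and lim: "(\<lambda>k. x (Suc (r k))) \<longlonglongrightarrow> xb" "(\<lambda>k. y (Suc (r k))) \<longlonglongrightarrow> yb"
      "(\<lambda>k. z (Suc (r k))) \<longlonglongrightarrow> zb" "(\<lambda>k. w (Suc (r k))) \<longlonglongrightarrow> wb"
  shows "xb = zb"
    and "\<exists>u\<in>limiting_subdiff h zb. \<exists>v\<in>cvx_subdiff g zb. gradf zb + u - v = 0"
    and "(\<lambda>n. objective (z n)) \<longlonglongrightarrow> objective zb"
    and "(\<lambda>n. bdr_merit f h g \<gamma> \<nu> (x n) (y n) (z n) (w n)) \<longlonglongrightarrow> bdr_merit f h g \<gamma> \<nu> xb yb zb wb"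
    and "bdr_merit f h g \<gamma> \<nu> xb yb zb wb = objective zb"
proof -
  note sub = LIMSEQ_subseq_LIMSEQ[OF _ r, unfolded o_def]
  have "(\<lambda>k. z (Suc (r k)) - x (Suc (r k))) \<longlonglongrightarrow> zb - xb"
    by (intro tendsto_intros lim)
  then have "zb - xb = 0"
    using sub[OF z_minus_x_null] LIMSEQ_unique by blast
  then show xz: "xb = zb"
    by simp
  \<comment> \<open>\<open>p (r k)\<close> is tied to \<open>z\<close> one index before the
    subsequence, so the increment of \<open>z\<close> enters.\<close>
  have "(\<lambda>k. z (Suc (r k)) - (z (Suc (r k)) - z (r k)) + (p (r k) - z (r k))) \<longlonglongrightarrow> zb - 0 + 0"
    by (intro tendsto_intros lim sub[OF z_diff_null] sub[OF p_minus_z_null])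
  then have p_lim: "(\<lambda>k. p (r k)) \<longlonglongrightarrow> zb"
    by simp
  have "(\<lambda>k. y (Suc (r k)) - (y (Suc (r k)) - y (r k))) \<longlonglongrightarrow> yb - 0"
    by (intro tendsto_intros lim sub[OF y_diff_null])
  then have y_lim: "(\<lambda>k. y (r k)) \<longlonglongrightarrow> yb"
    by simp
  have "(\<lambda>k. gradf (x (Suc (r k)))) \<longlonglongrightarrow> gradf xb"
    by (rule continuous_on_tendsto_compose[OF gradf_cont lim(1)]) auto
  then have "(\<lambda>k. x (Suc (r k)) + \<gamma> *\<^sub>R gradf (x (Suc (r k)))) \<longlonglongrightarrow> xb + \<gamma> *\<^sub>R gradf xb"
    by (intro tendsto_intros lim)
  then have yb: "yb = zb + \<gamma> *\<^sub>R gradf zb"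
    using y_lim xz LIMSEQ_unique unfolding y_eq by blast
  have wb: "wb \<in> cvx_subdiff g zb"
    by (rule cvx_subdiff_closed[OF g_cont w_in_cvx_subdiff p_lim lim(4)])
  obtain m where m: "(\<lambda>n. merit (Suc n)) \<longlonglongrightarrow> m"
    using merit_convergent by blast
  have obj_lim: "(\<lambda>n. obj (Suc n)) \<longlonglongrightarrow> m"
    using tendsto_diff[OF m merit_minus_obj_null] by simp
  \<comment> \<open>The value \<open>h zb\<close> must have for the objective at \<open>zb\<close>
    to equal \<open>m\<close>.\<close>
  define Hb where "Hb = m - f zb + g zb"
  have fg_lim: "(\<lambda>k. f (z (Suc (r k)))) \<longlonglongrightarrow> f zb" "(\<lambda>k. g (z (Suc (r k)))) \<longlonglongrightarrow> g zb"
    by (rule continuous_on_tendsto_compose[OF f_cont lim(3)] continuous_on_tendsto_compose[OF g_cont lim(3)];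
        simp)+
  have "(\<lambda>k. obj (Suc (r k)) - f (z (Suc (r k))) + g (z (Suc (r k)))) \<longlonglongrightarrow> Hb"
    unfolding Hb_def by (intro tendsto_intros fg_lim sub[OF obj_lim])
  then have H_lim: "(\<lambda>k. H (Suc (r k))) \<longlonglongrightarrow> Hb"
    by (simp add: obj_def)
  have h_le: "h zb \<le> ereal Hb"
    by (rule lsc_le_limit[OF h_lsc lim(3) h_z H_lim])
  then obtain hz where hz: "h zb = ereal hz"
    using h_nm[of zb] by (cases "h zb") auto
  define c where "c k = 2 *\<^sub>R x (Suc (r k)) - y (r k) + \<gamma> *\<^sub>R w (Suc (r k))" for k
  define cb where "cb = 2 *\<^sub>R xb - yb + \<gamma> *\<^sub>R wb"
  have c_lim: "c \<longlonglongrightarrow> cb"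
    unfolding c_def[abs_def] cb_def by (intro tendsto_intros lim y_lim)
  \<comment> \<open>Testing the \<open>z\<close>-step against \<open>zb\<close> and passing to the
    limit puts the same quadratic on both sides, leaving \<open>Hb \<le> hz\<close>.\<close>
  have "Hb + 1 / (2 * \<gamma>) * (norm (zb - cb))\<^sup>2 \<le> hz + 1 / (2 * \<gamma>) * (norm (zb - cb))\<^sup>2"
  proof (rule LIMSEQ_le)
    show "(\<lambda>k. H (Suc (r k)) + 1 / (2 * \<gamma>) * (norm (z (Suc (r k)) - c k))\<^sup>2)
        \<longlonglongrightarrow> Hb + 1 / (2 * \<gamma>) * (norm (zb - cb))\<^sup>2"
      by (intro tendsto_intros H_lim lim c_lim)
    show "(\<lambda>k. hz + 1 / (2 * \<gamma>) * (norm (zb - c k))\<^sup>2) \<longlonglongrightarrow> hz + 1 / (2 * \<gamma>) * (norm (zb - cb))\<^sup>2"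
      by (intro tendsto_intros c_lim)
    have "H (Suc (r k)) + 1 / (2 * \<gamma>) * (norm (z (Suc (r k)) - c k))\<^sup>2
        \<le> hz + 1 / (2 * \<gamma>) * (norm (zb - c k))\<^sup>2" for k
      using z_step[of "r k"] unfolding argmin_def c_def
      by (auto simp: h_z hz dest!: spec[of _ zb])
    then show "\<exists>N. \<forall>k\<ge>N. H (Suc (r k)) + 1 / (2 * \<gamma>) * (norm (z (Suc (r k)) - c k))\<^sup>2
        \<le> hz + 1 / (2 * \<gamma>) * (norm (zb - c k))\<^sup>2"
      by blast
  qed
  with h_le have h_zb: "h zb = ereal Hb"
    by (simp add: hz)
  have objective_zb: "objective zb = ereal m"
    by (simp add: objective_def h_zb Hb_def)
  \<comment> \<open>Fenchel equality at \<open>zb\<close> cancels the inner product, and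
    \<open>xb = zb\<close> cancels the quadratic terms.\<close>
  show bar: "bdr_merit f h g \<gamma> \<nu> xb yb zb wb = objective zb"
    unfolding bdr_merit_def fconj_eq_on_cvx_subdiff[OF wb] h_zb objective_zb xz
    by (simp add: Hb_def norm_minus_commute)
  have "(\<lambda>n. objective (z (Suc n))) \<longlonglongrightarrow> objective zb"
    unfolding objective_z objective_zb using obj_lim by (intro tendsto_intros)
  then show "(\<lambda>n. objective (z n)) \<longlonglongrightarrow> objective zb"
    by (rule LIMSEQ_imp_Suc)
  have "(\<lambda>n. bdr_merit f h g \<gamma> \<nu> (x (Suc n)) (y (Suc n)) (z (Suc n)) (w (Suc n))) \<longlonglongrightarrow> objective zb"
    unfolding bdr_merit_eq objective_zb using m by (intro tendsto_intros)
  then show "(\<lambda>n. bdr_merit f h g \<gamma> \<nu> (x n) (y n) (z n) (w n)) \<longlonglongrightarrow> bdr_merit f h g \<gamma> \<nu> xb yb zb wb"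
    unfolding bar by (rule LIMSEQ_imp_Suc)
  have "wb - gradf zb \<in> limiting_subdiff h zb"
    unfolding limiting_subdiff_def
  proof (intro CollectI exI conjI allI)
    show "(\<lambda>k. z (Suc (r k))) \<longlonglongrightarrow> zb"
      by (rule lim)
    show "(\<lambda>k. h (z (Suc (r k)))) \<longlonglongrightarrow> h zb"
      unfolding h_z h_zb using H_lim by (intro tendsto_intros)
    have "(\<lambda>k. (1 / \<gamma>) *\<^sub>R (c k - z (Suc (r k)))) \<longlonglongrightarrow> (1 / \<gamma>) *\<^sub>R (cb - zb)"
      by (intro tendsto_intros c_lim lim)
    also have "(1 / \<gamma>) *\<^sub>R (cb - zb) = (1 / \<gamma>) *\<^sub>R (\<gamma> *\<^sub>R (wb - gradf zb))"
      unfolding cb_def xz yb by (simp add: algebra_simps scaleR_2)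
    also have "\<dots> = wb - gradf zb"
      using gamma by simp
    finally show "(\<lambda>k. (1 / \<gamma>) *\<^sub>R (c k - z (Suc (r k)))) \<longlonglongrightarrow> wb - gradf zb" .
    show "(1 / \<gamma>) *\<^sub>R (c k - z (Suc (r k))) \<in> frechet_subdiff h (z (Suc (r k)))" for k
      by (rule argmin_prox_in_frechet_subdiff[OF gamma])
        (use z_step[of "r k"] in \<open>simp_all add: h_z c_def\<close>)
  qed
  with wb show "\<exists>u\<in>limiting_subdiff h zb. \<exists>v\<in>cvx_subdiff g zb. gradf zb + u - v = 0"
    by (intro bexI[of _ "wb - gradf zb"] bexI[of _ wb]) auto
qed

end

end

section \<open>Descent and convergence of the algorithm\<close>

theorem theorem3p5:
  fixes f g :: "'a::euclidean_space \<Rightarrow> real"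
    and gradf :: "'a \<Rightarrow> 'a"
    and h :: "'a \<Rightarrow> ereal"
    and \<rho> L \<gamma> \<tau> \<nu> :: real
    and x y z w :: "nat \<Rightarrow> 'a"
  assumes f_grad: "\<And>u. (f has_derivative (\<lambda>v. inner (gradf u) v)) (at u)"
    and f_wc: "weakly_convex \<rho> f" and rho: "\<rho> \<ge> 0"
    and grad_lip: "L-lipschitz_on UNIV gradf"
    and g_cont: "continuous_on UNIV g" and g_cvx: "convex_on UNIV g"
    and h_nm: "\<And>u. h u \<noteq> -\<infinity>" and h_proper: "\<exists>u. h u \<noteq> \<infinity>"
    and h_lsc: "lsc h"
    and gamma: "\<gamma> > 0" and tau: "\<tau> \<ge> 0" and nu: "0 < \<nu>" "\<nu> < 2"
    and gamma_bar: "L = 0 \<or>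
        \<gamma> < (- \<nu> * \<rho> + sqrt (\<nu>\<^sup>2 * \<rho>\<^sup>2 + 8 * (2 - \<nu>) * L\<^sup>2)) / (4 * L\<^sup>2)"
    and x_step: "\<And>n. x (Suc n) \<in> argmin (\<lambda>u. ereal (f u + 1 / (2 * \<gamma>) * (norm (u - y n))\<^sup>2))"
    and w_step: "\<And>n. w (Suc n) \<in> argmin (\<lambda>u. fconj g u
                     + ereal (- inner u (z n) + \<tau> / 2 * (norm (u - w n))\<^sup>2))"
    and z_step: "\<And>n. z (Suc n) \<in> argmin (\<lambda>u. h u
                     + ereal (1 / (2 * \<gamma>) *
                         (norm (u - (2 *\<^sub>R x (Suc n) - y n + \<gamma> *\<^sub>R w (Suc n))))\<^sup>2))"
    and y_step: "\<And>n. y (Suc n) = y n + \<nu> *\<^sub>R (z (Suc n) - x (Suc n))"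
  defines "\<delta> \<equiv> (2 - \<nu> - \<nu> * \<rho> * \<gamma> - 2 * L\<^sup>2 * \<gamma>\<^sup>2) / (\<nu> * \<gamma>)"
    and "Mrt \<equiv> (\<lambda>n. bdr_merit f h g \<gamma> \<nu> (x n) (y n) (z n) (w n))"
    and "F \<equiv> (\<lambda>u. ereal (f u) + h u - ereal (g u))"
  shows "(\<forall>n\<ge>1. Mrt (Suc n)
              + ereal (\<delta> / 2 * (norm (x (Suc n) - x n))\<^sup>2 + \<tau> / 2 * (norm (w (Suc n) - w n))\<^sup>2)
            \<le> Mrt n)
       \<and> (\<forall>n\<ge>1. Mrt (Suc n) \<le> Mrt n)
       \<and> (coercive F \<longrightarrow>
            bounded (range (\<lambda>n. (x (Suc n), y (Suc n), z (Suc n), w (Suc n))))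
          \<and> (\<lambda>n. norm (x (Suc n) - x n)) \<longlonglongrightarrow> 0
          \<and> (\<lambda>n. norm (y (Suc n) - y n)) \<longlonglongrightarrow> 0
          \<and> (\<lambda>n. norm (z (Suc n) - z n)) \<longlonglongrightarrow> 0
          \<and> (\<lambda>n. \<tau> * norm (w (Suc n) - w n)) \<longlonglongrightarrow> 0
          \<and> (\<forall>xb yb zb wb. (\<exists>r. strict_mono r \<and>
                 ((\<lambda>n. (x (Suc n), y (Suc n), z (Suc n), w (Suc n))) \<circ> r) \<longlonglongrightarrow> (xb, yb, zb, wb))
               \<longrightarrow> xb = zb
                 \<and> (\<exists>u\<in>limiting_subdiff h zb. \<exists>v\<in>cvx_subdiff g zb. gradf zb + u - v = 0)
                 \<and> (\<lambda>n. F (z n)) \<longlonglongrightarrow> F zb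
                 \<and> Mrt \<longlonglongrightarrow> bdr_merit f h g \<gamma> \<nu> xb yb zb wb
                 \<and> bdr_merit f h g \<gamma> \<nu> xb yb zb wb = F zb))"
proof -
  interpret backward_douglas_rachford f g gradf h \<rho> L \<gamma> \<tau> \<nu> x y z w
    by unfold_locales (fact assms)+
  have F_eq: "F = objective"
    unfolding F_def objective_def fun_eq_iff by simp
  have Mrt_Suc: "Mrt (Suc n) = ereal (merit (Suc n))" for n
    unfolding Mrt_def by (rule bdr_merit_eq)
  have decrease: "\<forall>n\<ge>1. Mrt (Suc n) + ereal (\<delta> / 2 * (norm (x (Suc n) - x n))\<^sup>2
      + \<tau> / 2 * (norm (w (Suc n) - w n))\<^sup>2) \<le> Mrt n"
  proof (intro allI impI)
    fix n :: nat assume "1 \<le> n"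
    then obtain k where k: "n = Suc k"
      by (cases n) auto
    \<comment> \<open>Passing from \<open>rate\<close> to the possibly smaller
      \<open>\<delta>\<close> only weakens the estimate.\<close>
    have "\<delta> / 2 * (norm (x (Suc n) - x n))\<^sup>2 \<le> rate / 2 * (norm (x (Suc n) - x n))\<^sup>2"
      using rate_ge unfolding \<delta>_def[symmetric] by (intro mult_right_mono divide_right_mono) auto
    then show "Mrt (Suc n) + ereal (\<delta> / 2 * (norm (x (Suc n) - x n))\<^sup>2
        + \<tau> / 2 * (norm (w (Suc n) - w n))\<^sup>2) \<le> Mrt n"
      using merit_decrease[of k] by (simp add: k Mrt_Suc)
  qed
  \<comment> \<open>Monotonicity rests on \<open>rate\<close>, which is always positive, whereas
    \<open>\<delta>\<close> can be negative when \<open>L = 0\<close>.\<close>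
  have nonincreasing: "\<forall>n\<ge>1. Mrt (Suc n) \<le> Mrt n"
  proof (intro allI impI)
    fix n :: nat assume "1 \<le> n"
    then obtain k where "n = Suc k"
      by (cases n) auto
    then show "Mrt (Suc n) \<le> Mrt n"
      using decseqD[OF merit_decseq, of k "Suc k"] by (simp add: Mrt_Suc)
  qed
  let ?s = "\<lambda>n. (x (Suc n), y (Suc n), z (Suc n), w (Suc n))"
  show ?thesis
  proof (intro conjI impI allI)
    assume c: "coercive F"
    then have coer: "coercive objective"
      by (simp add: F_eq)
    show "bounded (range ?s)"
      by (rule bounded_subset[OF bounded_Times[OF x_bounded[OF coer] bounded_Times[OF y_bounded[OF coer]
            bounded_Times[OF z_bounded[OF coer] w_bounded[OF coer]]]]]) auto
    show "(\<lambda>n. norm (x (Suc n) - x n)) \<longlonglongrightarrow> 0" "(\<lambda>n. norm (y (Suc n) - y n)) \<longlonglongrightarrow> 0"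
      "(\<lambda>n. norm (z (Suc n) - z n)) \<longlonglongrightarrow> 0"
      by (rule tendsto_norm_zero, rule x_diff_null[OF coer] y_diff_null[OF coer] z_diff_null[OF coer])+
    show "(\<lambda>n. \<tau> * norm (w (Suc n) - w n)) \<longlonglongrightarrow> 0"
      using tendsto_norm_zero[OF w_diff_null[OF coer]] tau by simp
    fix xb yb zb wb
    assume "\<exists>r. strict_mono r \<and> (?s \<circ> r) \<longlonglongrightarrow> (xb, yb, zb, wb)"
    then obtain r where r: "strict_mono r" and lim: "(\<lambda>k. ?s (r k)) \<longlonglongrightarrow> (xb, yb, zb, wb)"
      by (auto simp: o_def)
    note lim_snd = tendsto_snd[OF lim] tendsto_snd[OF tendsto_snd[OF lim]]
    have lims: "(\<lambda>k. x (Suc (r k))) \<longlonglongrightarrow> xb" "(\<lambda>k. y (Suc (r k))) \<longlonglongrightarrow> yb"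
        "(\<lambda>k. z (Suc (r k))) \<longlonglongrightarrow> zb" "(\<lambda>k. w (Suc (r k))) \<longlonglongrightarrow> wb"
      using tendsto_fst[OF lim] tendsto_fst[OF lim_snd(1)] tendsto_fst[OF lim_snd(2)]
        tendsto_snd[OF lim_snd(2)] by simp_all
    note cluster = cluster_point[OF coer r lims]
    show "xb = zb" "\<exists>u\<in>limiting_subdiff h zb. \<exists>v\<in>cvx_subdiff g zb. gradf zb + u - v = 0"
      by (fact cluster)+
    show "(\<lambda>n. F (z n)) \<longlonglongrightarrow> F zb" "bdr_merit f h g \<gamma> \<nu> xb yb zb wb = F zb"
      using cluster(3,5) by (simp_all only: F_eq)
    show "Mrt \<longlonglongrightarrow> bdr_merit f h g \<gamma> \<nu> xb yb zb wb"
      unfolding Mrt_def by (fact cluster)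
  qed (use decrease nonincreasing in blast)+
qed

end
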